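(* Let $Q_0=sat(u,l)$, where $u$ is a representation of a propositional formula in CNF and $l$ is the list of the variables in $u$. Then the occur-check is unnecessary for $P_3$ and $Q_0$ under any selection rule: for each SLD-derivation for $P_3$ starting from $Q_0$ (via any selection rule), whenever an atom $A$ selected in a query of the derivation is to be unified with the head $H$ of a (renamed apart) rule of $P_3$ with the same predicate symbol as $A$, the equation $A=H$ is NSTO (not subject to occur-check).
   Context: Prolog list notation is used ($[\,]$ is a constant, $[h|t]$ a binary constructor); $-$ is a binary function symbol written infix; $\mathtt{true},\mathtt{false}$ are constants. Representation of CNF formulae: propositional variables are represented as logical variables; a positive literal $x$ is represented as the term $\mathtt{true}-X$, a negative literal $\neg x$ as $\mathtt{false}-X$; a clause is represented as the list of the representations of its literals, and a conjunction of clauses as the list of the representations of the clauses. A set of equations $E$ is NSTO (not subject to occur-check) if in no execution of the (nondeterministic) Martelli–Montanari unification algorithm started with $E$ does one reach a set containing an equation $x=t$ with $x$ a variable, $t\neq x$ and $x$ occurring in $t$ (the situation in which the algorithm would halt with failure due to the occur-check). For atoms $A=p(a_1,\ldots,a_n)$ and $H=p(h_1,\ldots,h_n)$, the equation $A=H$ stands for the set $\{a_1=h_1,\ldots,a_n=h_n\}$. The definite clause program $P_3$ consists of the following rules (names beginning with upper-case letters are variables): 1. $sat\_cnf([\,])$. 2. $sat\_cnf([C|Cs])\gets sat\_cl(C), sat\_cnf(Cs)$. 3. $sat\_cl([P-V|R])\gets sat\_cl3(R,V,P)$. 4. ${=}(X,X)$. 5. $sat\_cl3([\,],V,P)\gets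 V=P$. 6. $sat\_cl3([P_2-V_2|R],V_1,P_1)\gets sat\_cl5(V_1,P_1,V_2,P_2,R)$. 7. $sat\_cl5(V_1,P_1,V_2,P_2,R)\gets sat\_cl5a(V_1,P_1,V_2,P_2,R)$. 8. $sat\_cl5(V_1,P_1,V_2,P_2,R)\gets sat\_cl5a(V_2,P_2,V_1,P_1,R)$. 9. $sat\_cl5a(V_1,P_1,V_2,P_2,R)\gets V_1=P_1$. 10. $sat\_cl5a(V_1,P_1,V_2,P_2,R)\gets sat\_cl3(R,V_2,P_2)$. 11. $sat(Cs,Vs)\gets sat\_cnf(Cs), tflist(Vs)$. 12. $tflist([\,])$. 13. $tflist([V|Vs])\gets tflist(Vs), tf(V)$. 14. $tf(\mathtt{true})$. 15. $tf(\mathtt{false})$. *)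

theory Defs
  imports Main "HOL-Library.Extended_Nat"
begin

text \<open>A function or predicate symbol is a name together with the number of arguments it is
  applied to, so equal names with argument lists of different lengths are different symbols.\<close>

datatype trm = Var string | Fn string "trm list"

datatype atom = Atom (pred: string) (args: "trm list")

datatype rule = Rule (head: atom) (body: "atom list")  (infix ":-" 50)

type_synonym program = "rule set"
type_synonym query = "atom list"
type_synonym subst = "string \<Rightarrow> trm"

fun vars_trm :: "trm \<Rightarrow> string set" where
  "vars_trm (Var x) = {x}"
| "vars_trm (Fn f ts) = (\<Union>t\<in>set ts. vars_trm t)"

definition vars_atom :: "atom \<Rightarrow> string set" where
  "vars_atom A = (\<Union>t\<in>set (args A). vars_trm t)"

definition vars_query :: "query \<Rightarrow> string set" where
  "vars_query Q = (\<Union>A\<in>set Q. vars_atom A)"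

definition vars_rule :: "rule \<Rightarrow> string set" where
  "vars_rule C = vars_atom (head C) \<union> vars_query (body C)"

fun app_trm :: "subst \<Rightarrow> trm \<Rightarrow> trm" where
  "app_trm \<theta> (Var x) = \<theta> x"
| "app_trm \<theta> (Fn f ts) = Fn f (map (app_trm \<theta>) ts)"

definition app_atom :: "subst \<Rightarrow> atom \<Rightarrow> atom" where
  "app_atom \<theta> A = Atom (pred A) (map (app_trm \<theta>) (args A))"

definition app_query :: "subst \<Rightarrow> query \<Rightarrow> query" where
  "app_query \<theta> Q = map (app_atom \<theta>) Q"

definition app_rule :: "subst \<Rightarrow> rule \<Rightarrow> rule" where
  "app_rule \<theta> C = (app_atom \<theta> (head C) :- app_query \<theta> (body C))"

definition dom_subst :: "subst \<Rightarrow> string set" where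
  "dom_subst \<theta> = {x. \<theta> x \<noteq> Var x}"

definition vars_subst :: "subst \<Rightarrow> string set" where
  "vars_subst \<theta> = dom_subst \<theta> \<union> (\<Union>x\<in>dom_subst \<theta>. vars_trm (\<theta> x))"

definition is_subst :: "subst \<Rightarrow> bool" where
  "is_subst \<theta> \<longleftrightarrow> finite (dom_subst \<theta>)"

definition variant :: "rule \<Rightarrow> rule \<Rightarrow> bool" where
  "variant C D \<longleftrightarrow> (\<exists>\<pi>::string \<Rightarrow> string. bij \<pi> \<and> C = app_rule (\<lambda>x. Var (\<pi> x)) D)"

text \<open>The pair \<open>(s, t)\<close> stands for the equation \<open>s = t\<close>.\<close>

type_synonym equations = "(trm \<times> trm) set"

definition same_pred :: "atom \<Rightarrow> atom \<Rightarrow> bool" where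
  "same_pred A H \<longleftrightarrow> pred A = pred H \<and> length (args A) = length (args H)"

definition atom_eqs :: "atom \<Rightarrow> atom \<Rightarrow> equations" where
  "atom_eqs A H = set (zip (args A) (args H))"

definition unifier :: "subst \<Rightarrow> equations \<Rightarrow> bool" where
  "unifier \<theta> E \<longleftrightarrow> is_subst \<theta> \<and> (\<forall>(s, t)\<in>E. app_trm \<theta> s = app_trm \<theta> t)"

definition mgu :: "subst \<Rightarrow> equations \<Rightarrow> bool" where
  "mgu \<theta> E \<longleftrightarrow> unifier \<theta> E \<and>
     (\<forall>\<sigma>. unifier \<sigma> E \<longrightarrow> (\<exists>\<delta>. is_subst \<delta> \<and> (\<forall>x. \<sigma> x = app_trm \<delta> (\<theta> x))))"

text \<open>The steps of the algorithm; the selected equation is arbitrary.  The two halting actions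
  (clash of distinct symbols, and occur-check failure) have no successor set.\<close>

inductive mm_step :: "equations \<Rightarrow> equations \<Rightarrow> bool" where
  decompose: "(Fn f ss, Fn f ts) \<in> E \<Longrightarrow> length ss = length ts \<Longrightarrow>
     mm_step E ((E - {(Fn f ss, Fn f ts)}) \<union> set (zip ss ts))"
| delete: "(Var x, Var x) \<in> E \<Longrightarrow> mm_step E (E - {(Var x, Var x)})"
| orient: "(Fn f ts, Var x) \<in> E \<Longrightarrow>
     mm_step E ((E - {(Fn f ts, Var x)}) \<union> {(Var x, Fn f ts)})"
| eliminate: "(Var x, t) \<in> E \<Longrightarrow> x \<notin> vars_trm t \<Longrightarrow>
     (\<exists>(s', t')\<in>E - {(Var x, t)}. x \<in> vars_trm s' \<union> vars_trm t') \<Longrightarrow>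
     mm_step E ((map_prod (app_trm (Var(x := t))) (app_trm (Var(x := t))) `
                   (E - {(Var x, t)})) \<union> {(Var x, t)})"

definition NSTO :: "equations \<Rightarrow> bool" where
  "NSTO E \<longleftrightarrow> \<not> (\<exists>E' x t. mm_step\<^sup>*\<^sup>* E E' \<and> (Var x, t) \<in> E' \<and> t \<noteq> Var x \<and> x \<in> vars_trm t)"

text \<open>A derivation with \<open>n\<close> steps, possibly \<open>n = \<infinity>\<close>, is given by its queries
  \<open>Q 0, Q 1, \<dots>\<close>, its input clauses \<open>C 0, C 1, \<dots>\<close> and its mgus \<open>\<theta> 0, \<theta> 1, \<dots>\<close>, where
  \<open>C i\<close> and \<open>\<theta> i\<close> are used to obtain \<open>Q (Suc i)\<close> from \<open>Q i\<close>; entries beyond the \<open>n\<close> steps are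
  irrelevant.  It need not be maximal.  A selection rule maps each initial fragment (the steps
  made so far and the current query) to the position of the selected atom.\<close>

type_synonym fragment = "(query \<times> rule \<times> subst) list \<times> query"

definition selection_rule :: "(fragment \<Rightarrow> nat) \<Rightarrow> bool" where
  "selection_rule R \<longleftrightarrow> (\<forall>h Q. Q \<noteq> [] \<longrightarrow> R (h, Q) < length Q)"

definition fragment :: "(nat \<Rightarrow> query) \<Rightarrow> (nat \<Rightarrow> rule) \<Rightarrow> (nat \<Rightarrow> subst) \<Rightarrow> nat \<Rightarrow> fragment" where
  "fragment Q C \<theta> i = (map (\<lambda>j. (Q j, C j, \<theta> j)) [0..<i], Q i)"

text \<open>\<open>D\<close> is a renamed apart rule of \<open>P\<close> that may be used at step \<open>i\<close>: it shares no variable with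
  the initial query nor with the input clauses and mgus of the previous steps.\<close>

definition renamed_apart ::
  "program \<Rightarrow> (nat \<Rightarrow> query) \<Rightarrow> (nat \<Rightarrow> rule) \<Rightarrow> (nat \<Rightarrow> subst) \<Rightarrow> nat \<Rightarrow> rule \<Rightarrow> bool" where
  "renamed_apart P Q C \<theta> i D \<longleftrightarrow>
     (\<exists>D0\<in>P. variant D D0) \<and>
     vars_rule D \<inter> (vars_query (Q 0) \<union> (\<Union>j<i. vars_rule (C j) \<union> vars_subst (\<theta> j))) = {}"

definition resolvent :: "query \<Rightarrow> nat \<Rightarrow> rule \<Rightarrow> subst \<Rightarrow> query" where
  "resolvent Q k C \<theta> = app_query \<theta> (take k Q @ body C @ drop (Suc k) Q)"

definition sld_derivation ::
  "program \<Rightarrow> (fragment \<Rightarrow> nat) \<Rightarrow> query \<Rightarrow> enat \<Rightarrow>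
   (nat \<Rightarrow> query) \<Rightarrow> (nat \<Rightarrow> rule) \<Rightarrow> (nat \<Rightarrow> subst) \<Rightarrow> bool" where
  "sld_derivation P R Q\<^sub>0 n Q C \<theta> \<longleftrightarrow>
     Q 0 = Q\<^sub>0 \<and>
     (\<forall>i. enat i < n \<longrightarrow>
        Q i \<noteq> [] \<and>
        renamed_apart P Q C \<theta> i (C i) \<and>
        (let k = R (fragment Q C \<theta> i) in
           same_pred (Q i ! k) (head (C i)) \<and>
           mgu (\<theta> i) (atom_eqs (Q i ! k) (head (C i))) \<and>
           Q (Suc i) = resolvent (Q i) k (C i) (\<theta> i)))"

text \<open>The rule \<open>D\<close> below need not be the one used in the derivation, and the unification may fail.\<close>

definition occur_check_unnecessary :: "program \<Rightarrow> query \<Rightarrow> (fragment \<Rightarrow> nat) \<Rightarrow> bool" where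
  "occur_check_unnecessary P Q\<^sub>0 R \<longleftrightarrow>
     (\<forall>n Q C \<theta> i D. sld_derivation P R Q\<^sub>0 n Q C \<theta> \<longrightarrow> enat i \<le> n \<longrightarrow> Q i \<noteq> [] \<longrightarrow>
        renamed_apart P Q C \<theta> i D \<longrightarrow>
        (let A = Q i ! R (fragment Q C \<theta> i) in
           same_pred A (head D) \<longrightarrow> NSTO (atom_eqs A (head D))))"

abbreviation nil_t :: trm where "nil_t \<equiv> Fn ''[]'' []"
abbreviation cons_t :: "trm \<Rightarrow> trm \<Rightarrow> trm" where "cons_t h t \<equiv> Fn ''[|]'' [h, t]"
abbreviation minus_t :: "trm \<Rightarrow> trm \<Rightarrow> trm" where "minus_t s t \<equiv> Fn ''-'' [s, t]"
abbreviation true_t :: trm where "true_t \<equiv> Fn ''true'' []"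
abbreviation false_t :: trm where "false_t \<equiv> Fn ''false'' []"

fun list_t :: "trm list \<Rightarrow> trm" where
  "list_t [] = nil_t"
| "list_t (t # ts) = cons_t t (list_t ts)"

datatype 'p lit = Pos 'p | Neg 'p

text \<open>A clause is a finite disjunction of literals, a CNF formula a finite conjunction of
  clauses; both are written as lists.\<close>

type_synonym 'p cnf = "'p lit list list"

fun var_lit :: "'p lit \<Rightarrow> 'p" where
  "var_lit (Pos p) = p"
| "var_lit (Neg p) = p"

definition vars_cnf :: "'p cnf \<Rightarrow> 'p set" where
  "vars_cnf F = (\<Union>c\<in>set F. var_lit ` set c)"

text \<open>\<open>\<rho> p\<close> is the logical variable that represents the propositional variable \<open>p\<close>.\<close>

fun rep_lit :: "('p \<Rightarrow> string) \<Rightarrow> 'p lit \<Rightarrow> trm" where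
  "rep_lit \<rho> (Pos p) = minus_t true_t (Var (\<rho> p))"
| "rep_lit \<rho> (Neg p) = minus_t false_t (Var (\<rho> p))"

definition rep_cnf :: "('p \<Rightarrow> string) \<Rightarrow> 'p cnf \<Rightarrow> trm" where
  "rep_cnf \<rho> F = list_t (map (\<lambda>c. list_t (map (rep_lit \<rho>) c)) F)"

definition represents :: "trm \<Rightarrow> 'p cnf \<Rightarrow> bool" where
  "represents u F \<longleftrightarrow> (\<exists>\<rho>. inj_on \<rho> (vars_cnf F) \<and> u = rep_cnf \<rho> F)"

definition P3 :: program where
  "P3 =
   (let C = Var ''C''; Cs = Var ''Cs''; P = Var ''P''; V = Var ''V''; R = Var ''R'';
        X = Var ''X''; Vs = Var ''Vs'';
        P1 = Var ''P1''; V1 = Var ''V1''; P2 = Var ''P2''; V2 = Var ''V2''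
    in
    { Atom ''sat_cnf'' [nil_t] :- [],
      Atom ''sat_cnf'' [cons_t C Cs] :- [Atom ''sat_cl'' [C], Atom ''sat_cnf'' [Cs]],
      Atom ''sat_cl'' [cons_t (minus_t P V) R] :- [Atom ''sat_cl3'' [R, V, P]],
      Atom ''='' [X, X] :- [],
      Atom ''sat_cl3'' [nil_t, V, P] :- [Atom ''='' [V, P]],
      Atom ''sat_cl3'' [cons_t (minus_t P2 V2) R, V1, P1] :-
        [Atom ''sat_cl5'' [V1, P1, V2, P2, R]],
      Atom ''sat_cl5'' [V1, P1, V2, P2, R] :- [Atom ''sat_cl5a'' [V1, P1, V2, P2, R]],
      Atom ''sat_cl5'' [V1, P1, V2, P2, R] :- [Atom ''sat_cl5a'' [V2, P2, V1, P1, R]],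
      Atom ''sat_cl5a'' [V1, P1, V2, P2, R] :- [Atom ''='' [V1, P1]],
      Atom ''sat_cl5a'' [V1, P1, V2, P2, R] :- [Atom ''sat_cl3'' [R, V2, P2]],
      Atom ''sat'' [Cs, Vs] :- [Atom ''sat_cnf'' [Cs], Atom ''tflist'' [Vs]],
      Atom ''tflist'' [nil_t] :- [],
      Atom ''tflist'' [cons_t V Vs] :- [Atom ''tflist'' [Vs], Atom ''tf'' [V]],
      Atom ''tf'' [true_t] :- [],
      Atom ''tf'' [false_t] :- [] })"

end

theory Submission
  imports Defs
begin

text \<open>Forget all function names, keeping only arities.  A set of equations, each of which either
  clashes by arity at the root or becomes true under one fixed valuation into nameless terms, is
  NSTO: this property is preserved by the Martelli-Montanari steps, and \<open>x = t\<close> with \<open>x\<close> strictly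
  inside \<open>t\<close> violates it.  Along a derivation from \<open>Q\<^sub>0\<close> every atom keeps its argument types, the
  leaves of which are variables, \<open>true\<close> and \<open>false\<close>.  Since \<open>true\<close> and \<open>false\<close> are identified
  when names are forgotten, the valuation sending all variables of the query to this common value
  extends to the variables of any rule head.\<close>

section \<open>Nameless evaluation\<close>

fun eval_trm :: "subst \<Rightarrow> trm \<Rightarrow> trm" where
  "eval_trm \<sigma> (Var x) = \<sigma> x"
| "eval_trm \<sigma> (Fn f ts) = Fn [] (map (eval_trm \<sigma>) ts)"

text \<open>No step applies to such an equation itself; eliminating with another equation only
  instantiates it, which keeps the clash.\<close>

fun arity_clash :: "trm \<Rightarrow> trm \<Rightarrow> bool" where
  "arity_clash (Fn f ss) (Fn g ts) \<longleftrightarrow> length ss \<noteq> length ts"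
| "arity_clash _ _ \<longleftrightarrow> False"

definition eval_compatible :: "subst \<Rightarrow> equations \<Rightarrow> bool" where
  "eval_compatible \<sigma> E \<longleftrightarrow> (\<forall>(s, t)\<in>E. eval_trm \<sigma> s = eval_trm \<sigma> t \<or> arity_clash s t)"

section \<open>Substitution, evaluation and size of terms\<close>

lemma app_trm_cong: "(\<And>x. x \<in> vars_trm t \<Longrightarrow> \<sigma> x = \<tau> x) \<Longrightarrow> app_trm \<sigma> t = app_trm \<tau> t"
  by (induction t) auto

lemma eval_trm_cong: "(\<And>x. x \<in> vars_trm t \<Longrightarrow> \<sigma> x = \<tau> x) \<Longrightarrow> eval_trm \<sigma> t = eval_trm \<tau> t"
  by (induction t) auto

lemma app_trm_app: "app_trm \<sigma> (app_trm \<tau> t) = app_trm (\<lambda>x. app_trm \<sigma> (\<tau> x)) t"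
  by (induction t) auto

lemma eval_trm_app: "eval_trm \<sigma> (app_trm \<tau> t) = eval_trm (\<lambda>x. eval_trm \<sigma> (\<tau> x)) t"
  by (induction t) auto

lemma app_trm_Var: "app_trm Var t = t"
  by (induction t) (auto simp: map_idI)

lemma vars_trm_app: "vars_trm (app_trm \<theta> t) = (\<Union>x\<in>vars_trm t. vars_trm (\<theta> x))"
  by (induction t) auto

lemma finite_vars_trm: "finite (vars_trm t)"
  by (induction t) auto

lemma finite_vars_atom: "finite (vars_atom A)"
  by (simp add: vars_atom_def finite_vars_trm)

lemma arity_clash_app: "arity_clash s t \<Longrightarrow> arity_clash (app_trm \<sigma> s) (app_trm \<tau> t)"
  by (cases s; cases t) auto

lemma size_eval_trm_ge: "x \<in> vars_trm t \<Longrightarrow> size (\<sigma> x) \<le> size (eval_trm \<sigma> t)"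
proof (induction t)
  case (Fn f ts)
  then obtain t where t: "t \<in> set ts" "x \<in> vars_trm t" by auto
  have "size (\<sigma> x) \<le> size (eval_trm \<sigma> t)" using Fn.IH t by blast
  also have "\<dots> \<le> size_list size (map (eval_trm \<sigma>) ts)"
    using t(1) by (intro size_list_estimation') auto
  finally show ?case by simp
qed simp

text \<open>The root symbol of \<open>t\<close> adds to the size of its value; hence no valuation
  can satisfy \<open>x = t\<close> when \<open>x\<close> lies strictly inside
  \<open>t\<close>.\<close>

lemma size_eval_trm_gr:
  assumes "x \<in> vars_trm t" "t \<noteq> Var x"
  shows "size (\<sigma> x) < size (eval_trm \<sigma> t)"
proof -
  obtain f ts where t: "t = Fn f ts" using assms by (cases t) auto
  then obtain t' where t': "t' \<in> set ts" "x \<in> vars_trm t'" using assms by auto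
  have "size (\<sigma> x) \<le> size (eval_trm \<sigma> t')" using size_eval_trm_ge t' by blast
  also have "\<dots> \<le> size_list size (map (eval_trm \<sigma>) ts)"
    using t'(1) by (intro size_list_estimation') auto
  finally show ?thesis by (simp add: t)
qed

text \<open>Equal nameless terms have equal arguments, which settles decomposition. Elimination
  replaces \<open>x\<close> by a term of the same value, so evaluations do not change, and arity
  clashes survive instantiation.\<close>

lemma eval_compatible_mm_step:
  assumes "mm_step E E'" "eval_compatible \<sigma> E"
  shows "eval_compatible \<sigma> E'"
  using assms
proof (induction rule: mm_step.induct)
  case (decompose f ss ts E)
  then have "map (eval_trm \<sigma>) ss = map (eval_trm \<sigma>) ts"
    by (force simp: eval_compatible_def)
  then have "eval_trm \<sigma> s = eval_trm \<sigma> t" if "(s, t) \<in> set (zip ss ts)" for s t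
    using that by (auto simp: in_set_zip dest: map_eq_imp_length_eq) (metis nth_map)
  then show ?case using decompose.prems by (auto simp: eval_compatible_def)
next
  case (delete x E)
  then show ?case by (auto simp: eval_compatible_def)
next
  case (orient f ts x E)
  then show ?case by (force simp: eval_compatible_def)
next
  case (eliminate x t E)
  \<comment> \<open>An equation with a variable side cannot clash, so it holds under
    \<open>\<sigma>\<close>.\<close>
  have x: "\<sigma> x = eval_trm \<sigma> t"
    using eliminate.hyps(1) eliminate.prems by (cases t) (force simp: eval_compatible_def)+
  then have "(\<lambda>y. eval_trm \<sigma> ((Var(x := t)) y)) = \<sigma>" by auto
  then have "eval_trm \<sigma> (app_trm (Var(x := t)) s) = eval_trm \<sigma> s" for s
    by (simp add: eval_trm_app del: fun_upd_apply)
  then have "eval_trm \<sigma> (app_trm (Var(x := t)) s) = eval_trm \<sigma> (app_trm (Var(x := t)) s') \<or>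
      arity_clash (app_trm (Var(x := t)) s) (app_trm (Var(x := t)) s')" if "(s, s') \<in> E" for s s'
    using that eliminate.prems arity_clash_app by (fastforce simp: eval_compatible_def)
  then show ?case using x by (fastforce simp: eval_compatible_def)
qed

lemma eval_compatible_imp_NSTO:
  assumes "eval_compatible \<sigma> E"
  shows "NSTO E"
  unfolding NSTO_def
proof (intro notI, elim exE conjE)
  fix E' x t
  assume "mm_step\<^sup>*\<^sup>* E E'" and t: "(Var x, t) \<in> E'" "t \<noteq> Var x" "x \<in> vars_trm t"
  from this(1) have "eval_compatible \<sigma> E'"
    by (induction) (auto intro: assms eval_compatible_mm_step)
  then have "\<sigma> x = eval_trm \<sigma> t"
    using t(1) by (cases t) (force simp: eval_compatible_def)+
  then show False using size_eval_trm_gr[OF t(3,2), of \<sigma>] by simp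
qed

section \<open>Types of atoms\<close>

definition is_const :: "trm \<Rightarrow> bool" where
  "is_const t \<longleftrightarrow> t = true_t \<or> t = false_t"

text \<open>The possible instances of a variable of the initial query during a derivation.\<close>

definition is_value :: "trm \<Rightarrow> bool" where
  "is_value t \<longleftrightarrow> is_const t \<or> (\<exists>x. t = Var x)"

inductive is_literal :: "trm \<Rightarrow> bool" where
  "is_const p \<Longrightarrow> is_value v \<Longrightarrow> is_literal (minus_t p v)"

inductive list_of :: "(trm \<Rightarrow> bool) \<Rightarrow> trm \<Rightarrow> bool" for T where
  list_of_nil: "list_of T nil_t"
| list_of_cons: "T h \<Longrightarrow> list_of T t \<Longrightarrow> list_of T (cons_t h t)"

text \<open>The invariant of all atoms in the queries. Polarity arguments are always constants, so
  \<open>=\<close> only ever compares a value with a constant.\<close>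

inductive typed :: "atom \<Rightarrow> bool" where
  "list_of (list_of is_literal) u \<Longrightarrow> list_of is_value l \<Longrightarrow> typed (Atom ''sat'' [u, l])"
| "list_of (list_of is_literal) u \<Longrightarrow> typed (Atom ''sat_cnf'' [u])"
| "list_of is_literal c \<Longrightarrow> typed (Atom ''sat_cl'' [c])"
| "list_of is_literal r \<Longrightarrow> is_value v \<Longrightarrow> is_const p \<Longrightarrow> typed (Atom ''sat_cl3'' [r, v, p])"
| "is_value v \<Longrightarrow> is_const p \<Longrightarrow> typed (Atom ''='' [v, p])"
| "is_value v \<Longrightarrow> is_const p \<Longrightarrow> is_value v' \<Longrightarrow> is_const p' \<Longrightarrow> list_of is_literal r \<Longrightarrow>
    typed (Atom ''sat_cl5'' [v, p, v', p', r])"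
| "is_value v \<Longrightarrow> is_const p \<Longrightarrow> is_value v' \<Longrightarrow> is_const p' \<Longrightarrow> list_of is_literal r \<Longrightarrow>
    typed (Atom ''sat_cl5a'' [v, p, v', p', r])"
| "list_of is_value l \<Longrightarrow> typed (Atom ''tflist'' [l])"
| "is_value v \<Longrightarrow> typed (Atom ''tf'' [v])"

inductive_simps is_literal_minus: "is_literal (minus_t p v)"
inductive_simps list_of_cons_iff: "list_of T (cons_t h t)"

inductive_simps typed_simps:
  "typed (Atom ''sat'' ts)" "typed (Atom ''sat_cnf'' ts)" "typed (Atom ''sat_cl'' ts)"
  "typed (Atom ''sat_cl3'' ts)" "typed (Atom ''='' ts)" "typed (Atom ''sat_cl5'' ts)"
  "typed (Atom ''sat_cl5a'' ts)" "typed (Atom ''tflist'' ts)" "typed (Atom ''tf'' ts)"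

section \<open>Closure of the types and matching with rule heads\<close>

lemma is_const_app: "is_const t \<Longrightarrow> is_const (app_trm \<theta> t)"
  by (auto simp: is_const_def)

lemma is_value_app: "is_value t \<Longrightarrow> \<forall>x\<in>vars_trm t. is_value (\<theta> x) \<Longrightarrow> is_value (app_trm \<theta> t)"
  by (auto simp: is_value_def is_const_def)

lemma is_literal_app:
  "is_literal t \<Longrightarrow> \<forall>x\<in>vars_trm t. is_value (\<theta> x) \<Longrightarrow> is_literal (app_trm \<theta> t)"
  by (induction rule: is_literal.induct) (simp add: is_literal_minus is_const_app is_value_app)

lemma list_of_app:
  assumes "list_of T t" "\<forall>x\<in>vars_trm t. is_value (\<theta> x)"
    and "\<And>t. T t \<Longrightarrow> \<forall>x\<in>vars_trm t. is_value (\<theta> x) \<Longrightarrow> T (app_trm \<theta> t)"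
  shows "list_of T (app_trm \<theta> t)"
  using assms(1,2)
  by (induction rule: list_of.induct) (auto intro!: list_of.intros assms(3))

lemma typed_app_atom:
  assumes "typed A" "\<forall>x\<in>vars_atom A. is_value (\<theta> x)"
  shows "typed (app_atom \<theta> A)"
  using assms
  by (induction rule: typed.induct)
    (auto simp: app_atom_def vars_atom_def typed_simps
      intro!: is_const_app is_value_app is_literal_app list_of_app)

text \<open>Organised by heads: rules with the same head are merged, and so are the two facts for
  \<open>tf\<close>.\<close>

lemma P3_cases:
  assumes "D \<in> P3"
  obtains "D = (Atom ''sat_cnf'' [nil_t] :- [])"
  | "D = (Atom ''sat_cnf'' [cons_t (Var ''C'') (Var ''Cs'')] :-
      [Atom ''sat_cl'' [Var ''C''], Atom ''sat_cnf'' [Var ''Cs'']])"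
  | "D = (Atom ''sat_cl'' [cons_t (minus_t (Var ''P'') (Var ''V'')) (Var ''R'')] :-
      [Atom ''sat_cl3'' [Var ''R'', Var ''V'', Var ''P'']])"
  | "D = (Atom ''='' [Var ''X'', Var ''X''] :- [])"
  | "D = (Atom ''sat_cl3'' [nil_t, Var ''V'', Var ''P''] :- [Atom ''='' [Var ''V'', Var ''P'']])"
  | "D = (Atom ''sat_cl3''
        [cons_t (minus_t (Var ''P2'') (Var ''V2'')) (Var ''R''), Var ''V1'', Var ''P1''] :-
      [Atom ''sat_cl5'' [Var ''V1'', Var ''P1'', Var ''V2'', Var ''P2'', Var ''R'']])"
  | B where "D = (Atom ''sat_cl5'' [Var ''V1'', Var ''P1'', Var ''V2'', Var ''P2'', Var ''R''] :- [B])"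
      "B = Atom ''sat_cl5a'' [Var ''V1'', Var ''P1'', Var ''V2'', Var ''P2'', Var ''R''] \<or>
       B = Atom ''sat_cl5a'' [Var ''V2'', Var ''P2'', Var ''V1'', Var ''P1'', Var ''R'']"
  | B where "D = (Atom ''sat_cl5a'' [Var ''V1'', Var ''P1'', Var ''V2'', Var ''P2'', Var ''R''] :- [B])"
      "B = Atom ''='' [Var ''V1'', Var ''P1''] \<or>
       B = Atom ''sat_cl3'' [Var ''R'', Var ''V2'', Var ''P2'']"
  | "D = (Atom ''sat'' [Var ''Cs'', Var ''Vs''] :-
      [Atom ''sat_cnf'' [Var ''Cs''], Atom ''tflist'' [Var ''Vs'']])"
  | "D = (Atom ''tflist'' [nil_t] :- [])"
  | "D = (Atom ''tflist'' [cons_t (Var ''V'') (Var ''Vs'')] :-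
      [Atom ''tflist'' [Var ''Vs''], Atom ''tf'' [Var ''V'']])"
  | c where "D = (Atom ''tf'' [c] :- [])" "is_const c"
  using assms unfolding P3_def Let_def insert_iff empty_iff is_const_def by metis

text \<open>All body variables occur in the head, and the type of the head instance fixes the types
  of the terms put for them.\<close>

lemma typed_body:
  assumes "D \<in> P3" "typed (app_atom \<tau> (head D))" "B \<in> set (body D)"
  shows "typed (app_atom \<tau> B)"
  using assms
  by (cases rule: P3_cases)
    (auto simp: app_atom_def typed_simps list_of_cons_iff is_literal_minus is_value_def)

text \<open>The two excluded predicates are the only ones whose arguments can be bound by a head.\<close>

lemma typed_match:
  assumes "typed A" "D \<in> P3" "same_pred A (head D)" "pred A \<noteq> ''=''" "pred A \<noteq> ''tf''"
  shows "\<exists>m. \<forall>(a, h)\<in>atom_eqs A (head D). a = app_trm m h \<or> arity_clash a h"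
proof -
  note defs = atom_eqs_def same_pred_def typed_simps
  obtain p ts where A: "A = Atom p ts" by (cases A)
  show ?thesis
    using assms(2)
  proof (cases rule: P3_cases)
    case 1
    \<comment> \<open>A typed argument is the empty list, which matches, or a nonempty one, which
      clashes with \<open>nil_t\<close>.\<close>
    then show ?thesis using assms(1,3) by (auto simp: A defs elim: list_of.cases)
  next
    case 2
    then obtain a where a: "ts = [a]" "list_of (list_of is_literal) a"
      using assms(1,3) by (auto simp: A defs)
    show ?thesis using a(2)
    proof cases
      case (list_of_cons h t)
      then show ?thesis
        by (intro exI[of _ "Var(''C'' := h, ''Cs'' := t)"]) (simp add: A 2 a atom_eqs_def)
    qed (simp add: A 2 a atom_eqs_def)
  next
    case 3
    then obtain a where a: "ts = [a]" "list_of is_literal a"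
      using assms(1,3) by (auto simp: A defs)
    show ?thesis using a(2)
    proof cases
      case (list_of_cons h t)
      then show ?thesis
        \<comment> \<open>The first element is a literal, so \<open>minus_t\<close> meets
          \<open>minus_t\<close>; \<open>p\<close> and \<open>v\<close> are its arguments.\<close>
        by (auto elim!: is_literal.cases simp: A 3 a atom_eqs_def)
          (rule_tac x = "Var(''P'' := p, ''V'' := v, ''R'' := t)" in exI, simp)
    qed (simp add: A 3 a atom_eqs_def)
  next
    case 5
    then obtain a v p where a: "ts = [a, v, p]" "list_of is_literal a"
      using assms(1,3) by (auto simp: A defs)
    show ?thesis using a(2)
      \<comment> \<open>One witness serves both list shapes: a nonempty list clashes, and the other
        two arguments match anyway.\<close>
      by cases (auto intro!: exI[of _ "Var(''V'' := v, ''P'' := p)"] simp: A 5 a atom_eqs_def)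
  next
    case 6
    then obtain a v1 p1 where a: "ts = [a, v1, p1]" "list_of is_literal a"
      using assms(1,3) by (auto simp: A defs)
    show ?thesis using a(2)
    proof cases
      case list_of_nil
      then show ?thesis
        by (intro exI[of _ "Var(''V1'' := v1, ''P1'' := p1)"]) (simp add: A 6 a atom_eqs_def)
    next
      case (list_of_cons h t)
      then show ?thesis
        by (auto elim!: is_literal.cases simp: A 6 a atom_eqs_def)
          (rule_tac x = "Var(''P2'' := p, ''V2'' := v, ''R'' := t, ''V1'' := v1, ''P1'' := p1)"
            in exI, simp)
    qed
  next
    case 7
    then obtain v1 p1 v2 p2 r where "ts = [v1, p1, v2, p2, r]"
      using assms(1,3) by (auto simp: A defs)
    then show ?thesis
      by (intro exI[of _ "Var(''V1'' := v1, ''P1'' := p1, ''V2'' := v2, ''P2'' := p2, ''R'' := r)"])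
        (simp add: A 7(1) atom_eqs_def)
  next
    case 8
    then obtain v1 p1 v2 p2 r where "ts = [v1, p1, v2, p2, r]"
      using assms(1,3) by (auto simp: A defs)
    then show ?thesis
      by (intro exI[of _ "Var(''V1'' := v1, ''P1'' := p1, ''V2'' := v2, ''P2'' := p2, ''R'' := r)"])
        (simp add: A 8(1) atom_eqs_def)
  next
    case 9
    then obtain u l where "ts = [u, l]" using assms(1,3) by (auto simp: A defs)
    then show ?thesis
      by (intro exI[of _ "Var(''Cs'' := u, ''Vs'' := l)"]) (simp add: A 9 atom_eqs_def)
  next
    case 10
    then show ?thesis using assms(1,3) by (auto simp: A defs elim: list_of.cases)
  next
    case 11
    then obtain a where a: "ts = [a]" "list_of is_value a"
      using assms(1,3) by (auto simp: A defs)
    show ?thesis using a(2)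
    proof cases
      case (list_of_cons h t)
      then show ?thesis
        by (intro exI[of _ "Var(''V'' := h, ''Vs'' := t)"]) (simp add: A 11 a atom_eqs_def)
    qed (simp add: A 11 a atom_eqs_def)
  qed (use assms(3-5) in \<open>simp_all add: same_pred_def\<close>)
qed

section \<open>Unification with a renamed apart head\<close>

lemma app_atom_cong:
  "(\<And>x. x \<in> vars_atom A \<Longrightarrow> \<sigma> x = \<tau> x) \<Longrightarrow> app_atom \<sigma> A = app_atom \<tau> A"
  by (auto simp: app_atom_def vars_atom_def intro!: app_trm_cong)

lemma app_atom_app: "app_atom \<sigma> (app_atom \<tau> A) = app_atom (\<lambda>x. app_trm \<sigma> (\<tau> x)) A"
  by (simp add: app_atom_def app_trm_app)

lemma vars_atom_app: "vars_atom (app_atom \<theta> A) = (\<Union>x\<in>vars_atom A. vars_trm (\<theta> x))"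
  by (auto simp: app_atom_def vars_atom_def vars_trm_app)

lemma app_atom_eq_iff:
  assumes "same_pred A H"
  shows "app_atom \<sigma> A = app_atom \<tau> H \<longleftrightarrow> (\<forall>(a, h)\<in>atom_eqs A H. app_trm \<sigma> a = app_trm \<tau> h)"
  using assms
  by (auto simp: app_atom_def same_pred_def atom_eqs_def list_eq_iff_nth_eq in_set_zip)

lemma atom_eqs_app:
  "atom_eqs A (app_atom \<tau> H) = map_prod id (app_trm \<tau>) ` atom_eqs A H"
  by (simp add: atom_eqs_def app_atom_def zip_map2 map_prod_def id_def)

text \<open>Since the variables are disjoint, the atom and the original head may be evaluated by
  unrelated valuations \<open>\<sigma>\<close> and \<open>\<mu>\<close>, which are then glued
  together.\<close>

lemma NSTO_rename:
  assumes "bij \<pi>"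
    and disj: "vars_atom A \<inter> vars_atom (app_atom (\<lambda>x. Var (\<pi> x)) H) = {}"
    and ok: "\<forall>(a, h)\<in>atom_eqs A H. eval_trm \<sigma> a = eval_trm \<mu> h \<or> arity_clash a h"
  shows "NSTO (atom_eqs A (app_atom (\<lambda>x. Var (\<pi> x)) H))"
proof (rule eval_compatible_imp_NSTO)
  let ?\<rho> = "\<lambda>x. Var (\<pi> x)"
  \<comment> \<open>Variables of the renamed head are traced back to the original rule by
    \<open>inv \<pi>\<close>.\<close>
  define \<eta> where "\<eta> = (\<lambda>x. if x \<in> vars_atom A then \<sigma> x else \<mu> (inv \<pi> x))"
  have "eval_trm \<eta> a = eval_trm \<eta> (app_trm ?\<rho> h) \<or> arity_clash a (app_trm ?\<rho> h)"
    if ah: "(a, h) \<in> atom_eqs A H" for a h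
  proof -
    have sub: "a \<in> set (args A)" "h \<in> set (args H)"
      using ah by (auto simp: atom_eqs_def dest: set_zip_leftD set_zip_rightD)
    have "eval_trm \<eta> a = eval_trm \<sigma> a"
      using sub by (intro eval_trm_cong) (auto simp: \<eta>_def vars_atom_def)
    moreover have "eval_trm \<eta> (app_trm ?\<rho> h) = eval_trm \<mu> h"
      unfolding eval_trm_app
    proof (rule eval_trm_cong)
      fix x assume "x \<in> vars_trm h"
      then have "\<pi> x \<notin> vars_atom A"
        using disj sub by (auto simp: vars_atom_app) (auto simp: vars_atom_def)
      then show "eval_trm \<eta> (?\<rho> x) = \<mu> x"
        using \<open>bij \<pi>\<close> by (simp add: \<eta>_def bij_is_inj)
    qed
    moreover have "arity_clash a h \<Longrightarrow> arity_clash a (app_trm ?\<rho> h)"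
      using arity_clash_app[of a h Var ?\<rho>] by (simp add: app_trm_Var)
    ultimately show ?thesis using ok ah by auto
  qed
  then show "eval_compatible \<eta> (atom_eqs A (app_atom ?\<rho> H))"
    by (fastforce simp: eval_compatible_def atom_eqs_app)
qed

text \<open>The same gluing for unifiers. Agreement with \<open>s\<close> off the head later gives
  control over the query variables.\<close>

lemma unifier_rename:
  assumes "bij \<pi>" "same_pred A H" "is_subst s"
    and disj: "vars_atom A \<inter> vars_atom (app_atom (\<lambda>x. Var (\<pi> x)) H) = {}"
    and eq: "app_atom s A = app_atom m H"
  obtains \<sigma> where "unifier \<sigma> (atom_eqs A (app_atom (\<lambda>x. Var (\<pi> x)) H))"
    and "\<And>x. x \<notin> vars_atom (app_atom (\<lambda>x. Var (\<pi> x)) H) \<Longrightarrow> \<sigma> x = s x"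
proof
  let ?H = "app_atom (\<lambda>x. Var (\<pi> x)) H"
  \<comment> \<open>\<open>m\<close> may move infinitely many variables; using it only on the
    finitely many of the head keeps \<open>\<sigma>\<close> a substitution.\<close>
  define \<sigma> where "\<sigma> = (\<lambda>x. if x \<in> vars_atom ?H then m (inv \<pi> x) else s x)"
  have "dom_subst \<sigma> \<subseteq> vars_atom ?H \<union> dom_subst s"
    by (auto simp: dom_subst_def \<sigma>_def)
  then have "is_subst \<sigma>"
    using \<open>is_subst s\<close> finite_vars_atom[of ?H] by (auto simp: is_subst_def intro: finite_subset)
  moreover have "app_atom \<sigma> A = app_atom s A"
    using disj by (intro app_atom_cong) (auto simp: \<sigma>_def)
  moreover have "app_atom \<sigma> ?H = app_atom m H"
    unfolding app_atom_app using \<open>bij \<pi>\<close>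
    by (intro app_atom_cong) (auto simp: \<sigma>_def vars_atom_app bij_is_inj)
  moreover have "same_pred A ?H"
    using assms(2) by (simp add: same_pred_def app_atom_def)
  ultimately show "unifier \<sigma> (atom_eqs A ?H)"
    using eq app_atom_eq_iff[of A ?H \<sigma> \<sigma>] by (auto simp: unifier_def)
  show "\<And>x. x \<notin> vars_atom ?H \<Longrightarrow> \<sigma> x = s x" by (simp add: \<sigma>_def)
qed

section \<open>Typed atoms: NSTO and preservation of types by resolution\<close>

lemma eval_value: "is_value t \<Longrightarrow> eval_trm (\<lambda>_. Fn [] []) t = Fn [] []"
  by (auto simp: is_value_def is_const_def)

lemma typed_NSTO:
  assumes "typed A" "D0 \<in> P3" "variant D D0" "same_pred A (head D)"
    and "vars_atom A \<inter> vars_rule D = {}"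
  shows "NSTO (atom_eqs A (head D))"
proof -
  obtain \<pi> where \<pi>: "bij \<pi>" and D: "head D = app_atom (\<lambda>x. Var (\<pi> x)) (head D0)"
    using assms(3) by (auto simp: variant_def app_rule_def)
  have sp: "same_pred A (head D0)"
    using assms(4) by (simp add: D same_pred_def app_atom_def)
  let ?b = "\<lambda>_::string. Fn [] []"
  have "\<exists>\<mu>. \<forall>(a, h)\<in>atom_eqs A (head D0). eval_trm ?b a = eval_trm \<mu> h \<or> arity_clash a h"
  proof (cases "pred A = ''='' \<or> pred A = ''tf''")
    case True
    \<comment> \<open>The head of \<open>=\<close> repeats a variable and that of \<open>tf\<close>
      is a constant, so matching may fail; but all arguments are values, and all values evaluate
      alike.\<close>
    have "\<forall>(a, h)\<in>atom_eqs A (head D0). is_value a \<and> is_value h"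
      using assms(2,1) sp True
      by (cases rule: P3_cases; cases A)
        (auto simp: same_pred_def typed_simps atom_eqs_def is_value_def)
    then show ?thesis by (intro exI[of _ ?b]) (auto simp: eval_value)
  next
    case False
    then obtain m where "\<forall>(a, h)\<in>atom_eqs A (head D0). a = app_trm m h \<or> arity_clash a h"
      using typed_match assms(1,2) sp by blast
    then show ?thesis
      by (intro exI[of _ "\<lambda>x. eval_trm ?b (m x)"]) (auto simp: eval_trm_app)
  qed
  moreover have "vars_atom A \<inter> vars_atom (head D) = {}"
    using assms(5) by (auto simp: vars_rule_def)
  ultimately show ?thesis using NSTO_rename[OF \<pi>] by (auto simp: D)
qed

text \<open>Provides a unifier with values only, to be compared with the mgu. Outside
  \<open>=\<close> and \<open>tf\<close> the atom need not be instantiated; for these two, at most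
  one variable is bound, to a constant.\<close>

lemma typed_value_match:
  assumes "typed A" "D \<in> P3" "same_pred A (head D)" "app_atom \<theta> A = app_atom \<tau> (head D)"
  obtains s m where "is_subst s" "\<And>x. is_value (s x)" "app_atom s A = app_atom m (head D)"
proof (cases "pred A = ''='' \<or> pred A = ''tf''")
  case False
  then obtain m where m: "\<forall>(a, h)\<in>atom_eqs A (head D). a = app_trm m h \<or> arity_clash a h"
    using typed_match assms(1-3) by blast
  \<comment> \<open>Clashing terms have no equal instances, so unifiability leaves only the match,
    and \<open>s = Var\<close> works.\<close>
  have "a = app_trm m h" if ah: "(a, h) \<in> atom_eqs A (head D)" for a h
  proof -
    have "app_trm \<theta> a = app_trm \<tau> h"
      using app_atom_eq_iff[OF assms(3)] assms(4) ah by blast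
    then have "\<not> arity_clash a h"
      by (cases a; cases h) (auto dest: map_eq_imp_length_eq)
    then show ?thesis using m ah by auto
  qed
  then have "app_atom Var A = app_atom m (head D)"
    by (auto simp: app_atom_eq_iff[OF assms(3)] app_trm_Var)
  then show ?thesis using that[of Var m] by (simp add: is_subst_def dom_subst_def is_value_def)
next
  case True
  have subst: "is_subst (Var(y := c))" "is_subst Var" for y c
    by (auto simp: is_subst_def dom_subst_def intro: finite_subset[of _ "{y}"])
  have val: "is_value ((Var(y := c)) x)" "is_value (Var x)" if "is_const c" for y c x
    using that by (auto simp: is_value_def)
  \<comment> \<open>Common form of both predicates: \<open>v\<close> must become the constant
    \<open>c\<close>, which is the second argument of the atom for \<open>=\<close> and the head
    argument for \<open>tf\<close>.\<close>
  obtain v c where v: "is_value v" "is_const c" "app_trm \<theta> v = c"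
    and A: "\<And>s. app_trm s v = c \<Longrightarrow> app_atom s A = app_atom (\<lambda>_. c) (head D)"
  proof (cases "pred A = ''=''")
    case True
    then obtain v c where "A = Atom ''='' [v, c]" "is_value v" "is_const c"
      using assms(1) by (cases A) (auto simp: typed_simps)
    moreover have "head D = Atom ''='' [Var ''X'', Var ''X'']"
      using assms(2,3) True by (cases rule: P3_cases) (auto simp: same_pred_def)
    ultimately show ?thesis using assms(4) that[of v c]
      by (auto simp: app_atom_def is_const_def)
  next
    case False
    then have "pred A = ''tf''" using True by simp
    then obtain v where "A = Atom ''tf'' [v]" "is_value v"
      using assms(1) by (cases A) (auto simp: typed_simps)
    moreover obtain c where "head D = Atom ''tf'' [c]" "is_const c"
      using assms(2,3) \<open>pred A = ''tf''\<close> by (cases rule: P3_cases) (auto simp: same_pred_def)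
    ultimately show ?thesis using assms(4) that[of v c]
      by (auto simp: app_atom_def is_const_def)
  qed
  show ?thesis
  proof (cases v)
    case (Var y)
    then show ?thesis
      using that[of "Var(y := c)" "\<lambda>_. c"] subst val[OF v(2)] A by simp
  next
    case (Fn f ts)
    \<comment> \<open>Here \<open>v\<close> is a constant, fixed by \<open>\<theta>\<close>, hence
      already \<open>c\<close>.\<close>
    then have "app_trm Var v = c" using v by (auto simp: is_value_def is_const_def)
    then show ?thesis
      using that[of Var "\<lambda>_. c"] subst val[OF v(2)] A by simp
  qed
qed

text \<open>A non-variable term keeps its root symbol and arity under instantiation, so generalising
  a value cannot lead outside the values.\<close>

lemma is_value_if_instance: "is_value (app_trm \<delta> t) \<Longrightarrow> is_value t"
  by (cases t) (auto simp: is_value_def is_const_def)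

text \<open>The mgu is more general than a unifier with values on the query variables, so it sends
  them to values too. Hence query atoms stay typed, and body atoms get their types from the head,
  whose instance is that of the selected atom.\<close>

lemma typed_resolvent:
  assumes typed: "\<forall>A\<in>set Q. typed A" and "k < length Q"
    and D0: "D0 \<in> P3" and "variant D D0" "vars_query Q \<inter> vars_rule D = {}"
    and sp: "same_pred (Q ! k) (head D)" and mgu: "mgu \<theta> (atom_eqs (Q ! k) (head D))"
  shows "\<forall>A\<in>set (resolvent Q k D \<theta>). typed A"
proof -
  let ?A = "Q ! k"
  obtain \<pi> where \<pi>: "bij \<pi>" and D: "D = app_rule (\<lambda>x. Var (\<pi> x)) D0"
    using assms(4) by (auto simp: variant_def)
  then have hD: "head D = app_atom (\<lambda>x. Var (\<pi> x)) (head D0)"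
    by (simp add: app_rule_def)
  have sp0: "same_pred ?A (head D0)"
    using sp by (simp add: hD same_pred_def app_atom_def)
  have A: "?A \<in> set Q" using \<open>k < length Q\<close> by simp
  have disj: "vars_atom ?A \<inter> vars_atom (head D) = {}"
    using assms(5) A by (auto simp: vars_query_def vars_rule_def)
  have unif: "app_atom \<theta> ?A = app_atom (\<lambda>x. \<theta> (\<pi> x)) (head D0)"
    using mgu app_atom_eq_iff[OF sp, of \<theta> \<theta>]
    by (auto simp: mgu_def unifier_def hD app_atom_app)
  obtain s m where s: "is_subst s" "\<And>x. is_value (s x)" "app_atom s ?A = app_atom m (head D0)"
    using typed_value_match[OF _ D0 sp0 unif] typed A by blast
  obtain \<sigma> where \<sigma>: "unifier \<sigma> (atom_eqs ?A (head D))"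
    "\<And>x. x \<notin> vars_atom (head D) \<Longrightarrow> \<sigma> x = s x"
    using unifier_rename[OF \<pi> sp0 s(1) _ s(3)] disj unfolding hD by metis
  obtain \<delta> where \<delta>: "\<And>x. \<sigma> x = app_trm \<delta> (\<theta> x)"
    using mgu \<sigma>(1) by (auto simp: mgu_def)
  have val: "is_value (\<theta> x)" if "x \<in> vars_query Q" for x
  proof -
    \<comment> \<open>\<open>\<sigma>\<close> can differ from \<open>s\<close> only on head
      variables, and these are not in the query.\<close>
    have "\<sigma> x = s x" using that assms(5) \<sigma>(2) by (auto simp: vars_rule_def)
    then show ?thesis using \<delta>[of x] s(2)[of x] is_value_if_instance by metis
  qed
  have query: "typed (app_atom \<theta> B)" if "B \<in> set Q" for B
    using that typed val by (intro typed_app_atom) (auto simp: vars_query_def)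
  have "typed (app_atom \<theta> B)" if B: "B \<in> set (body D)" for B
  proof -
    obtain B0 where "B0 \<in> set (body D0)" "B = app_atom (\<lambda>x. Var (\<pi> x)) B0"
      using B by (auto simp: D app_rule_def app_query_def)
    then show ?thesis
      using typed_body[OF D0, of "\<lambda>x. \<theta> (\<pi> x)" B0] query[OF A] unif by (simp add: app_atom_app)
  qed
  with query show ?thesis
    by (auto simp: resolvent_def app_query_def dest: in_set_takeD in_set_dropD)
qed

section \<open>Variables and types along a derivation\<close>

lemma vars_query_resolvent:
  "vars_query (resolvent Q k D \<theta>) \<subseteq> vars_query Q \<union> vars_rule D \<union> vars_subst \<theta>"
proof -
  have "vars_trm (\<theta> x) \<subseteq> {x} \<union> vars_subst \<theta>" for x
    by (cases "x \<in> dom_subst \<theta>") (auto simp: vars_subst_def dom_subst_def)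
  then have "vars_atom (app_atom \<theta> B) \<subseteq> vars_atom B \<union> vars_subst \<theta>" for B
    by (auto simp: vars_atom_app)
  then show ?thesis
    by (fastforce simp: resolvent_def app_query_def vars_query_def vars_rule_def
        dest: in_set_takeD in_set_dropD)
qed

text \<open>\<open>renamed_apart\<close> speaks only of the initial query and earlier clauses and
  mgus. Bounding the variables of the current query by these yields the disjointness that
  \<open>typed_resolvent\<close> requires, so both claims share one induction.\<close>

lemma sld_derivation_typed:
  assumes "sld_derivation P3 R Q\<^sub>0 n Q C \<theta>" "selection_rule R" "\<forall>A\<in>set Q\<^sub>0. typed A"
    and "enat i \<le> n"
  shows "(\<forall>A\<in>set (Q i). typed A) \<and>
    vars_query (Q i) \<subseteq> vars_query (Q 0) \<union> (\<Union>j<i. vars_rule (C j) \<union> vars_subst (\<theta> j))"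
  using assms(4)
proof (induction i)
  case 0
  then show ?case using assms(1,3) by (simp add: sld_derivation_def)
next
  case (Suc i)
  then have i: "enat i < n" by (simp add: Suc_ile_eq)
  define k where "k = R (fragment Q C \<theta> i)"
  have step: "Q i \<noteq> []" "renamed_apart P3 Q C \<theta> i (C i)" "same_pred (Q i ! k) (head (C i))"
    "mgu (\<theta> i) (atom_eqs (Q i ! k) (head (C i)))" "Q (Suc i) = resolvent (Q i) k (C i) (\<theta> i)"
    using assms(1) i by (auto simp: sld_derivation_def k_def Let_def)
  have k: "k < length (Q i)"
    using assms(2) step(1) by (simp add: k_def selection_rule_def fragment_def)
  have IH: "\<forall>A\<in>set (Q i). typed A"
    "vars_query (Q i) \<subseteq> vars_query (Q 0) \<union> (\<Union>j<i. vars_rule (C j) \<union> vars_subst (\<theta> j))"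
    using Suc.IH i by auto
  obtain D0 where "D0 \<in> P3" "variant (C i) D0" "vars_query (Q i) \<inter> vars_rule (C i) = {}"
    using step(2) IH(2) unfolding renamed_apart_def by blast
  then have "\<forall>A\<in>set (Q (Suc i)). typed A"
    using typed_resolvent[OF IH(1) k] step by metis
  moreover have "vars_query (Q (Suc i)) \<subseteq> vars_query (Q i) \<union> vars_rule (C i) \<union> vars_subst (\<theta> i)"
    using vars_query_resolvent step(5) by simp
  ultimately show ?case using IH(2) by (fastforce simp: lessThan_Suc)
qed

section \<open>The initial query and the conclusion\<close>

lemma list_of_list_t: "\<forall>t\<in>set ts. T t \<Longrightarrow> list_of T (list_t ts)"
  by (induction ts) (auto intro: list_of.intros)

lemma is_literal_rep_lit: "is_literal (rep_lit \<rho> x)"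
  by (cases x) (auto simp: is_literal_minus is_const_def is_value_def)

theorem mainTheorem5:
  fixes F :: "'p cnf" and u l :: trm and xs :: "string list" and R :: "fragment \<Rightarrow> nat"
  assumes "represents u F"
    and "set xs = vars_trm u" and "l = list_t (map Var xs)"
    and "selection_rule R"
  shows "occur_check_unnecessary P3 [Atom ''sat'' [u, l]] R"
  unfolding occur_check_unnecessary_def Let_def
proof (intro allI impI)
  fix n Q C \<theta> i D
  assume der: "sld_derivation P3 R [Atom ''sat'' [u, l]] n Q C \<theta>" and i: "enat i \<le> n"
    and ne: "Q i \<noteq> []" and ra: "renamed_apart P3 Q C \<theta> i D"
    and sp: "same_pred (Q i ! R (fragment Q C \<theta> i)) (head D)"
  have "list_of (list_of is_literal) u"
    using assms(1) by (auto simp: represents_def rep_cnf_def is_literal_rep_lit intro!: list_of_list_t)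
  moreover have "list_of is_value l"
    using assms(3) by (auto simp: is_value_def intro!: list_of_list_t)
  ultimately have "\<forall>A\<in>set [Atom ''sat'' [u, l]]. typed A" by (simp add: typed_simps)
  note inv = sld_derivation_typed[OF der assms(4) this i]
  have "Q i ! R (fragment Q C \<theta> i) \<in> set (Q i)"
    using assms(4) ne by (simp add: selection_rule_def fragment_def)
  \<comment> \<open>The variable bound separates the current query from any candidate
    \<open>D\<close>, not only from the clause used.\<close>
  moreover obtain D0 where "D0 \<in> P3" "variant D D0" "vars_query (Q i) \<inter> vars_rule D = {}"
    using ra inv unfolding renamed_apart_def by blast
  ultimately show "NSTO (atom_eqs (Q i ! R (fragment Q C \<theta> i)) (head D))"
    using inv sp by (intro typed_NSTO) (auto simp: vars_query_def)
qed

end
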